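(* Let $m,n\in\mathbb{N}$ and let $F\colon\mathbb{R}^n\to\mathbb{C}^{m\times m}$. Then the following conditions (i) and (ii) are equivalent: (i) $F$ is conditionally positive semidefinite. (ii) For all $t>0$, the Hadamard exponential $\exp_H(tF)\colon\mathbb{R}^n\to\mathbb{C}^{m\times m}$ is positive semidefinite. If one of conditions (i) or (ii) holds, and if $F(0)\le 0$, then the following condition (iii) holds: (iii) For all $N\in\mathbb{N}$ and all $x_p\in\mathbb{R}^n$, $1\le p\le N$, the block matrix $\{F(x_p-x_q)-F(x_p)-F(x_q)^*\}_{1\le p,q\le N}\in\mathbb{C}^{mN\times mN}$ is positive semidefinite.
   Context: A matrix $A\in\mathbb{C}^{M\times M}$ is positive semidefinite ($A\ge 0$) if $\sum_{j,k=1}^M\overline{c_j}A_{j,k}c_k\ge 0$ for all $c\in\mathbb{C}^M$; $A\le 0$ means $-A\ge 0$. A self-adjoint matrix $A=A^*\in\mathbb{C}^{M\times M}$ is conditionally positive semidefinite if $\sum_{j,k=1}^M\overline{c_j}A_{j,k}c_k\ge 0$ for all $c=(c_1,\dots,c_M)^\top\in\mathbb{C}^M$ with $\sum_{j=1}^M c_j=0$ (self-adjointness is part of the definition). A function $F\colon\mathbb{R}^n\to\mathbb{C}^{m\times m}$ is positive semidefinite (respectively, conditionally positive semidefinite) if for all $N\in\mathbb{N}$ and $x_1,\dots,x_N\in\mathbb{R}^n$ the block matrix $\{F(x_p-x_q)\}_{1\le p,q\le N}\in\mathbb{C}^{mN\times mN}$ (with $(p,q)$-block $F(x_p-x_q)$)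 is positive semidefinite (respectively, conditionally positive semidefinite). The Hadamard exponential of $G\colon\mathbb{R}^n\to\mathbb{C}^{m\times m}$ is the entrywise exponential: $\exp_H(G(x))_{j,k}=\exp(G(x)_{j,k})$, $1\le j,k\le m$, $x\in\mathbb{R}^n$. *)

theory Defs
  imports "HOL-Analysis.Finite_Cartesian_Product" "Jordan_Normal_Form.Schur_Decomposition"
begin

text \<open>Complex matrices of numeric size are the matrices of Jordan-Normal-Form (indices start
  at 0). In the order on the complex numbers, 0 \<le> z means that z is real and nonnegative.\<close>

unbundle no vec_syntax

definition quad_form :: "complex mat \<Rightarrow> complex Matrix.vec \<Rightarrow> complex" where
  "quad_form A c = (\<Sum>j<dim_row A. \<Sum>k<dim_col A. cnj (c $ j) * A $$ (j, k) * c $ k)"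

definition pos_semidef :: "complex mat \<Rightarrow> bool" where
  "pos_semidef A \<longleftrightarrow> square_mat A \<and>
     (\<forall>c \<in> carrier_vec (dim_row A). 0 \<le> quad_form A c)"

definition neg_semidef :: "complex mat \<Rightarrow> bool" where
  "neg_semidef A \<longleftrightarrow> pos_semidef (- A)"

definition cond_pos_semidef :: "complex mat \<Rightarrow> bool" where
  "cond_pos_semidef A \<longleftrightarrow> square_mat A \<and> mat_adjoint A = A \<and>
     (\<forall>c \<in> carrier_vec (dim_row A).
        (\<Sum>j<dim_row A. c $ j) = 0 \<longrightarrow> 0 \<le> quad_form A c)"

text \<open>The matrix of size m N whose (p, q)-block, for p, q < N, is the m by m matrix B p q.\<close>

definition block_mat :: "nat \<Rightarrow> nat \<Rightarrow> (nat \<Rightarrow> nat \<Rightarrow> complex mat) \<Rightarrow> complex mat" where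
  "block_mat m N B = mat (m * N) (m * N)
     (\<lambda>(i, j). B (i div m) (j div m) $$ (i mod m, j mod m))"

text \<open>In the next two definitions the values of F are m by m matrices, and only the points
  x 0, ..., x (N - 1) enter the block matrix.\<close>

definition pos_semidef_fun :: "nat \<Rightarrow> (real ^ 'n \<Rightarrow> complex mat) \<Rightarrow> bool" where
  "pos_semidef_fun m F \<longleftrightarrow>
     (\<forall>(N::nat) (x :: nat \<Rightarrow> real ^ 'n). pos_semidef (block_mat m N (\<lambda>p q. F (x p - x q))))"

definition cond_pos_semidef_fun :: "nat \<Rightarrow> (real ^ 'n \<Rightarrow> complex mat) \<Rightarrow> bool" where
  "cond_pos_semidef_fun m F \<longleftrightarrow>
     (\<forall>(N::nat) (x :: nat \<Rightarrow> real ^ 'n). cond_pos_semidef (block_mat m N (\<lambda>p q. F (x p - x q))))"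

definition exp_H :: "(real ^ 'n \<Rightarrow> complex mat) \<Rightarrow> real ^ 'n \<Rightarrow> complex mat" where
  "exp_H G x = map_mat exp (G x)"

end

theory Submission
  imports Defs
begin

text \<open>A block matrix is a kernel on a finite index set, so the equivalence is Schoenberg's theorem
  for kernels. If \<open>K\<close> is conditionally positive semidefinite and \<open>a\<close> is an index, the centered kernel
  \<open>K i j - K i a - K a j + K a a\<close> is positive semidefinite, and so is its entrywise exponential, by the
  Schur product theorem and the exponential series; \<open>exp (K i j)\<close> differs from it by a rank one factor
  \<open>u i * cnj (u j)\<close>. Conversely, \<open>K\<close> is the limit of \<open>(exp (t K) - 1) / t\<close>, and subtracting a constant
  does not change the form on vectors of total weight zero. For (iii) one applies (i) to the points
  \<open>x 0, \<dots>, x (N - 1), 0, \<dots>, 0\<close> with weights \<open>c\<close> on the first half and \<open>- c\<close> on the second; the extra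
  term \<open>F 0\<close> that appears has the right sign.\<close>

section \<open>Positive semidefinite kernels\<close>

text \<open>Kernels on an arbitrary index set, rather than on \<open>{..<n}\<close>, permit
  induction by removal of one index and pullback along maps.\<close>

definition hform :: "'a set \<Rightarrow> ('a \<Rightarrow> 'a \<Rightarrow> complex) \<Rightarrow> ('a \<Rightarrow> complex) \<Rightarrow> complex" where
  "hform S K c = (\<Sum>i\<in>S. \<Sum>j\<in>S. cnj (c i) * K i j * c j)"

definition psd_kernel :: "'a set \<Rightarrow> ('a \<Rightarrow> 'a \<Rightarrow> complex) \<Rightarrow> bool" where
  "psd_kernel S K \<longleftrightarrow> (\<forall>c. 0 \<le> hform S K c)"

text \<open>For \<open>psd_kernel\<close> Hermitian symmetry follows from the form, but here it does
  not: a kernel \<open>\<lambda>i j. u i\<close> has form zero on every vector of total weight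
  zero.\<close>

definition cpsd_kernel :: "'a set \<Rightarrow> ('a \<Rightarrow> 'a \<Rightarrow> complex) \<Rightarrow> bool" where
  "cpsd_kernel S K \<longleftrightarrow> (\<forall>i\<in>S. \<forall>j\<in>S. K j i = cnj (K i j)) \<and>
     (\<forall>c. sum c S = 0 \<longrightarrow> 0 \<le> hform S K c)"

lemma cpsd_kernel_hermitian:
  "cpsd_kernel S K \<Longrightarrow> i \<in> S \<Longrightarrow> j \<in> S \<Longrightarrow> K j i = cnj (K i j)"
  unfolding cpsd_kernel_def by blast

lemma cpsd_kernel_nonneg: "cpsd_kernel S K \<Longrightarrow> sum c S = 0 \<Longrightarrow> 0 \<le> hform S K c"
  unfolding cpsd_kernel_def by blast

lemma hform_cong:
  assumes "\<And>i j. i \<in> S \<Longrightarrow> j \<in> S \<Longrightarrow> K i j = L i j" and "\<And>i. i \<in> S \<Longrightarrow> c i = d i"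
  shows "hform S K c = hform S L d"
  unfolding hform_def using assms by (intro sum.cong refl) auto

lemma psd_kernel_cong:
  assumes "\<And>i j. i \<in> S \<Longrightarrow> j \<in> S \<Longrightarrow> K i j = L i j"
  shows "psd_kernel S K \<longleftrightarrow> psd_kernel S L"
proof -
  have "hform S K c = hform S L c" for c by (intro hform_cong assms refl)
  then show ?thesis by (simp add: psd_kernel_def)
qed

lemma hform_add: "hform S (\<lambda>i j. K i j + L i j) c = hform S K c + hform S L c"
  by (simp add: hform_def algebra_simps sum.distrib)

lemma hform_diff: "hform S (\<lambda>i j. K i j - L i j) c = hform S K c - hform S L c"
  by (simp add: hform_def algebra_simps sum_subtractf)

lemma hform_scale: "hform S (\<lambda>i j. a * K i j) c = a * hform S K c"
  by (simp add: hform_def sum_distrib_left mult_ac)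

lemma hform_rank1:
  "hform S (\<lambda>i j. u i * v j) c = (\<Sum>i\<in>S. cnj (c i) * u i) * (\<Sum>j\<in>S. v j * c j)"
  by (simp add: hform_def sum_product mult.assoc)

lemma hform_insert:
  assumes "finite S" "a \<notin> S"
  shows "hform (insert a S) K c =
    hform S K c + cnj (c a) * (\<Sum>j\<in>S. K a j * c j) + (\<Sum>i\<in>S. cnj (c i) * K i a) * c a
      + cnj (c a) * K a a * c a"
  using assms
  by (simp add: hform_def sum.distrib sum_distrib_left sum_distrib_right algebra_simps)

text \<open>Indices are grouped by their image under \<open>f\<close>, and the weights on one fibre
  add up; \<open>f\<close> may fail to be injective.\<close>

lemma hform_pullback:
  assumes "finite S" "finite T" "f ` T \<subseteq> S"
  shows "hform T (\<lambda>i j. K (f i) (f j)) c = hform S K (\<lambda>s. \<Sum>i | i \<in> T \<and> f i = s. c i)"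
proof -
  have group: "sum g T = (\<Sum>s\<in>S. \<Sum>i | i \<in> T \<and> f i = s. g i)" for g :: "'b \<Rightarrow> complex"
    by (rule sum.group[OF assms(2,1,3), symmetric])
  have "hform T (\<lambda>i j. K (f i) (f j)) c =
      (\<Sum>s\<in>S. \<Sum>i | i \<in> T \<and> f i = s. \<Sum>t\<in>S. \<Sum>j | j \<in> T \<and> f j = t. cnj (c i) * K (f i) (f j) * c j)"
    unfolding hform_def group ..
  also have "\<dots> = (\<Sum>s\<in>S. \<Sum>i | i \<in> T \<and> f i = s. \<Sum>t\<in>S. \<Sum>j | j \<in> T \<and> f j = t. cnj (c i) * K s t * c j)"
    by (intro sum.cong refl) auto
  also have "\<dots> = (\<Sum>s\<in>S. \<Sum>t\<in>S. \<Sum>i | i \<in> T \<and> f i = s. \<Sum>j | j \<in> T \<and> f j = t. cnj (c i) * K s t * c j)"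
    by (intro sum.cong refl) (rule sum.swap)
  also have "\<dots> = hform S K (\<lambda>s. \<Sum>i | i \<in> T \<and> f i = s. c i)"
    unfolding hform_def
  proof (intro sum.cong refl)
    fix s t
    show "(\<Sum>i | i \<in> T \<and> f i = s. \<Sum>j | j \<in> T \<and> f j = t. cnj (c i) * K s t * c j) =
        cnj (\<Sum>i | i \<in> T \<and> f i = s. c i) * K s t * (\<Sum>j | j \<in> T \<and> f j = t. c j)"
      unfolding cnj_sum sum_distrib_right[of _ _ "K s t"] sum_product ..
  qed
  finally show ?thesis .
qed

lemma psd_kernel_pullback:
  assumes "psd_kernel S K" "finite S" "finite T" "f ` T \<subseteq> S"
  shows "psd_kernel T (\<lambda>i j. K (f i) (f j))"
  using assms(1) unfolding psd_kernel_def hform_pullback[OF assms(2-4)] by blast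

section \<open>Two-point forms: diagonal, Hermitian symmetry, zero diagonal entries\<close>

lemma psd_kernel_two_points:
  assumes "psd_kernel S K" "finite S" "i \<in> S" "j \<in> S"
  shows "0 \<le> cnj a * K i i * a + cnj a * K i j * b + cnj b * K j i * a + cnj b * K j j * b"
proof -
  \<comment> \<open>Indexing by truth values keeps two separate weights even when
    \<open>i = j\<close>.\<close>
  have "psd_kernel {True, False} (\<lambda>p q. K (if p then i else j) (if q then i else j))"
    using assms by (intro psd_kernel_pullback[OF assms(1,2)]) auto
  then have "0 \<le> hform {True, False} (\<lambda>p q. K (if p then i else j) (if q then i else j))
      (\<lambda>p. if p then a else b)"
    unfolding psd_kernel_def by blast
  then show ?thesis by (simp add: hform_def add_ac)
qed

lemma psd_kernel_diag:
  assumes "psd_kernel S K" "finite S" "i \<in> S"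
  shows "0 \<le> K i i"
  using psd_kernel_two_points[OF assms(1,2,3,3), of 1 0] by simp

text \<open>Polarization: nonnegative values are real, so the weights \<open>1, 1\<close> give
  \<open>Im (K i j + K j i) = 0\<close> and the weights \<open>1, \<i>\<close> give
  \<open>Re (K i j) = Re (K j i)\<close>.\<close>

lemma psd_kernel_hermitian:
  assumes "psd_kernel S K" "finite S" "i \<in> S" "j \<in> S"
  shows "K j i = cnj (K i j)"
proof -
  have "0 \<le> K i i" "0 \<le> K j j" using psd_kernel_diag assms by metis+
  moreover have "0 \<le> K i i + K i j + K j i + K j j"
    using psd_kernel_two_points[OF assms, of 1 1] by simp
  moreover have "0 \<le> K i i + K i j * \<i> - \<i> * K j i - \<i> * K j j * \<i>"
    using psd_kernel_two_points[OF assms, of 1 \<i>] by simp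
  ultimately show ?thesis by (auto simp: less_eq_complex_def complex_eq_iff)
qed

text \<open>With \<open>K j j = 0\<close> the two-point form is affine in the weight at
  \<open>j\<close>, and an affine function that is bounded below has no linear part.\<close>

lemma psd_kernel_zero_diag:
  assumes "psd_kernel S K" "finite S" "i \<in> S" "j \<in> S" "K j j = 0"
  shows "K i j = 0"
proof (rule ccontr)
  assume nz: "K i j \<noteq> 0"
  define r where "r = (cmod (K i j))\<^sup>2"
  have r: "r > 0" using nz by (simp add: r_def)
  have h: "K j i = cnj (K i j)" by (rule psd_kernel_hermitian[OF assms(1-4)])
  have norm: "K i j * cnj (K i j) = of_real r"
    unfolding r_def by (rule complex_norm_square[symmetric])
  \<comment> \<open>This choice gives the form the real part \<open>- Re (K i i) - 2\<close>, which
    is negative.\<close>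
  define s where "s = (Re (K i i) + 1) / r"
  have "0 \<le> K i i - of_real s * (K i j * cnj (K i j)) - of_real s * (K i j * cnj (K i j))"
    using psd_kernel_two_points[OF assms(1-4), of 1 "- of_real s * cnj (K i j)"]
    by (simp add: assms(5) h mult_ac)
  then have "0 \<le> Re (K i i) - 2 * (s * r)"
    unfolding norm by (simp add: less_eq_complex_def mult_ac)
  moreover have "s * r = Re (K i i) + 1" using r by (simp add: s_def)
  moreover have "0 \<le> Re (K i i)" using psd_kernel_diag[OF assms(1-3)] by (simp add: less_eq_complex_def)
  ultimately show False by simp
qed

section \<open>Rank one kernels, sums, Schur complements and entrywise products\<close>

lemma cnj_mult_self_nonneg: "0 \<le> cnj z * z"
  by (simp add: less_eq_complex_def)

lemma psd_kernel_rank1: "psd_kernel S (\<lambda>i j. u i * cnj (u j))"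
proof -
  have "hform S (\<lambda>i j. u i * cnj (u j)) c = cnj (\<Sum>i\<in>S. cnj (u i) * c i) * (\<Sum>i\<in>S. cnj (u i) * c i)" for c
    unfolding hform_rank1 by (simp add: mult_ac)
  then show ?thesis by (simp only: psd_kernel_def cnj_mult_self_nonneg simp_thms)
qed

lemma psd_kernel_add: "psd_kernel S K \<Longrightarrow> psd_kernel S L \<Longrightarrow> psd_kernel S (\<lambda>i j. K i j + L i j)"
  by (simp add: psd_kernel_def hform_add)

lemma psd_kernel_scale: "0 \<le> a \<Longrightarrow> psd_kernel S K \<Longrightarrow> psd_kernel S (\<lambda>i j. a * K i j)"
  by (simp add: psd_kernel_def hform_scale)

text \<open>For \<open>K a a = 0\<close> the quotient is \<open>0\<close> and the lemma remains true.\<close>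

lemma psd_kernel_schur_complement:
  assumes "psd_kernel (insert a S) K" "finite S" "a \<notin> S"
  shows "psd_kernel S (\<lambda>i j. K i j - K i a * K a j / K a a)"
  unfolding psd_kernel_def
proof
  fix c :: "'a \<Rightarrow> complex"
  define l where "l = (\<Sum>j\<in>S. K a j * c j)"
  \<comment> \<open>If \<open>K a a \<noteq> 0\<close>, this weight solves
    \<open>l + K a a * c' a = 0\<close>, so the two terms of \<open>hform_insert\<close> with the
    factor \<open>cnj (c' a)\<close> cancel.\<close>
  define c' where "c' = c(a := - (l / K a a))"
  have eq: "c' j = c j" if "j \<in> S" for j using that assms(3) by (auto simp: c'_def)
  have s: "hform S K c' = hform S K c" "(\<Sum>j\<in>S. K a j * c' j) = l"
    "(\<Sum>i\<in>S. cnj (c' i) * K i a) = (\<Sum>i\<in>S. cnj (c i) * K i a)"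
    unfolding l_def using eq by (auto intro!: hform_cong sum.cong)
  have "hform S (\<lambda>i j. K i j - K i a * K a j / K a a) c =
      hform S (\<lambda>i j. K i j - K i a * (K a j / K a a)) c" by simp
  also have "\<dots> = hform S K c - (\<Sum>i\<in>S. cnj (c i) * K i a) * (l / K a a)"
    unfolding hform_diff hform_rank1 by (simp add: l_def sum_divide_distrib)
  also have "\<dots> = hform (insert a S) K c'"
    unfolding hform_insert[OF assms(2,3)] s by (simp add: c'_def)
  also have "0 \<le> \<dots>" using assms(1) by (simp add: psd_kernel_def)
  finally show "0 \<le> hform S (\<lambda>i j. K i j - K i a * K a j / K a a) c" .
qed

text \<open>The Schur product theorem, by induction on the index set: \<open>K\<close> splits into its Schur complement
  at \<open>a\<close>, whose row and column at \<open>a\<close> vanish, and a rank one kernel.\<close>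

lemma psd_kernel_mult:
  assumes "finite S" "psd_kernel S K" "psd_kernel S L"
  shows "psd_kernel S (\<lambda>i j. K i j * L i j)"
  using assms
\<comment> \<open>\<open>K\<close> is generalized because the induction hypothesis is applied to its
  Schur complement, whereas \<open>L\<close> is merely restricted.\<close>
proof (induction S arbitrary: K rule: finite_induct)
  case empty
  then show ?case by (simp add: psd_kernel_def hform_def)
next
  case (insert a S)
  define K' where "K' i j = K i j - K i a * K a j / K a a" for i j
  have fin: "finite (insert a S)" using insert by simp
  have "psd_kernel S L"
    using psd_kernel_pullback[OF insert.prems(2) fin insert.hyps(1), of id] by auto
  then have IH: "psd_kernel S (\<lambda>i j. K' i j * L i j)"
    unfolding K'_def
    by (intro insert.IH psd_kernel_schur_complement[OF insert.prems(1) insert.hyps])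
  have herm: "K i j = cnj (K j i)" if "i \<in> insert a S" "j \<in> insert a S" for i j
    using psd_kernel_hermitian[OF insert.prems(1) fin] that by blast
  \<comment> \<open>Arithmetic if \<open>K a a \<noteq> 0\<close>; otherwise
    \<open>K' i a = K i a\<close>, and the zero diagonal entry makes the column of \<open>K\<close>
    vanish.\<close>
  have col: "K' i a = 0" if "i \<in> insert a S" for i
    using psd_kernel_zero_diag[OF insert.prems(1) fin that, of a] by (auto simp: K'_def)
  have row: "K' a i = 0" if "i \<in> insert a S" for i
    using psd_kernel_zero_diag[OF insert.prems(1) fin that, of a] herm[OF _ that, of a]
    by (auto simp: K'_def)
  have Kaa: "0 \<le> K a a" using psd_kernel_diag[OF insert.prems(1) fin] by simp
  then obtain r where r: "K a a = complex_of_real r" "0 \<le> r"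
    by (metis less_eq_complex_def complex_is_Real_iff Reals_cases Re_complex_of_real zero_complex.sel)
  have "1 / K a a = complex_of_real (1 / r)" by (simp add: r)
  then have inv: "0 \<le> 1 / K a a" using r(2) by (simp only:) (simp add: less_eq_complex_def)
  show ?case
    unfolding psd_kernel_def
  proof
    fix c
    have "hform (insert a S) (\<lambda>i j. K i j * L i j) c =
        hform (insert a S) (\<lambda>i j. K' i j * L i j + (1 / K a a) * (K i a * L i j * K a j)) c"
      by (intro hform_cong refl) (simp add: K'_def algebra_simps)
    also have "\<dots> = hform (insert a S) (\<lambda>i j. K' i j * L i j) c +
        (1 / K a a) * hform (insert a S) (\<lambda>i j. K i a * L i j * K a j) c"
      unfolding hform_add hform_scale ..
    also have "hform (insert a S) (\<lambda>i j. K' i j * L i j) c = hform S (\<lambda>i j. K' i j * L i j) c"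
      unfolding hform_insert[OF insert.hyps] using row col by simp
    \<comment> \<open>Since \<open>K i a = cnj (K a i)\<close>, the rank one factor is absorbed into
      the weights.\<close>
    also have "hform (insert a S) (\<lambda>i j. K i a * L i j * K a j) c =
        hform (insert a S) L (\<lambda>j. K a j * c j)"
      unfolding hform_def
      using herm[OF _ insertI1, symmetric] by (intro sum.cong refl) (simp add: mult_ac)
    also have "0 \<le> hform S (\<lambda>i j. K' i j * L i j) c +
        1 / K a a * hform (insert a S) L (\<lambda>j. K a j * c j)"
      using IH insert.prems(2) inv unfolding psd_kernel_def
      by (intro add_nonneg_nonneg mult_nonneg_nonneg) auto
    finally show "0 \<le> hform (insert a S) (\<lambda>i j. K i j * L i j) c" .
  qed
qed

section \<open>Pointwise limits of kernels\<close>

lemma nonneg_complex_LIMSEQ: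
  fixes f :: "nat \<Rightarrow> complex"
  assumes "f \<longlonglongrightarrow> z" and "\<And>n. 0 \<le> f n"
  shows "0 \<le> z"
proof -
  have "0 \<le> Re z"
    using assms(2) by (intro LIMSEQ_le_const[OF tendsto_Re[OF assms(1)]]) (auto simp: less_eq_complex_def)
  moreover have "(\<lambda>n. Im (f n)) = (\<lambda>n. 0)" using assms(2) by (auto simp: less_eq_complex_def)
  then have "Im z = 0"
    using tendsto_Im[OF assms(1)] by (simp add: LIMSEQ_const_iff)
  ultimately show ?thesis by (simp add: less_eq_complex_def)
qed

lemma hform_LIMSEQ:
  assumes "\<And>i j. i \<in> S \<Longrightarrow> j \<in> S \<Longrightarrow> (\<lambda>n. Kn n i j) \<longlonglongrightarrow> K i j"
  shows "(\<lambda>n. hform S (Kn n) c) \<longlonglongrightarrow> hform S K c"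
  unfolding hform_def by (intro tendsto_sum tendsto_mult tendsto_const assms)

lemma psd_kernel_LIMSEQ:
  assumes "\<And>n. psd_kernel S (Kn n)"
    and "\<And>i j. i \<in> S \<Longrightarrow> j \<in> S \<Longrightarrow> (\<lambda>n. Kn n i j) \<longlonglongrightarrow> K i j"
  shows "psd_kernel S K"
  unfolding psd_kernel_def
proof
  fix c
  have "(\<lambda>n. hform S (Kn n) c) \<longlonglongrightarrow> hform S K c" by (intro hform_LIMSEQ assms(2))
  then show "0 \<le> hform S K c"
    by (rule nonneg_complex_LIMSEQ) (use assms(1) in \<open>simp add: psd_kernel_def\<close>)
qed

lemma cpsd_kernel_LIMSEQ:
  assumes "\<And>n. cpsd_kernel S (Kn n)"
    and lim: "\<And>i j. i \<in> S \<Longrightarrow> j \<in> S \<Longrightarrow> (\<lambda>n. Kn n i j) \<longlonglongrightarrow> K i j"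
  shows "cpsd_kernel S K"
  unfolding cpsd_kernel_def
proof (intro conjI ballI allI impI)
  fix i j assume ij: "i \<in> S" "j \<in> S"
  have "Kn n j i = cnj (Kn n i j)" for n by (rule cpsd_kernel_hermitian[OF assms(1) ij])
  then show "K j i = cnj (K i j)"
    using LIMSEQ_unique[OF lim[OF ij(2,1)]] tendsto_cnj[OF lim[OF ij]] by simp
next
  fix c :: "'a \<Rightarrow> complex" assume c: "sum c S = 0"
  have "(\<lambda>n. hform S (Kn n) c) \<longlonglongrightarrow> hform S K c" by (intro hform_LIMSEQ lim)
  then show "0 \<le> hform S K c"
    by (rule nonneg_complex_LIMSEQ) (rule cpsd_kernel_nonneg[OF assms(1) c])
qed

section \<open>Entrywise exponentials and Schoenberg's theorem\<close>

lemma psd_kernel_exp: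
  assumes "finite S" "psd_kernel S K"
  shows "psd_kernel S (\<lambda>i j. exp (K i j))"
proof -
  have pow: "psd_kernel S (\<lambda>i j. K i j ^ n)" for n
  proof (induction n)
    case 0
    then show ?case using psd_kernel_rank1[of S "\<lambda>_. 1"] by simp
  next
    case (Suc n)
    then show ?case using psd_kernel_mult[OF assms] by simp
  qed
  have "psd_kernel S (\<lambda>i j. \<Sum>k<n. K i j ^ k /\<^sub>R fact k)" for n
  proof (induction n)
    case 0
    then show ?case by (simp add: psd_kernel_def hform_def)
  next
    case (Suc n)
    have "psd_kernel S (\<lambda>i j. of_real (inverse (fact n)) * K i j ^ n)"
      by (intro psd_kernel_scale pow) (simp add: less_eq_complex_def)
    from psd_kernel_add[OF Suc this] show ?case by (simp add: scaleR_conv_of_real)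
  qed
  then show ?thesis
    by (rule psd_kernel_LIMSEQ) (use exp_converges in \<open>simp add: sums_def\<close>)
qed

text \<open>The centered kernel vanishes on the row and column of \<open>a\<close>, so the weight
  there is free. Setting it to minus the sum of the others gives total weight zero, and on that
  vector \<open>K\<close> has the same form as the centered kernel has on \<open>c\<close>.\<close>

lemma cpsd_kernel_centered:
  assumes "finite S" "cpsd_kernel S K" "a \<in> S"
  shows "psd_kernel S (\<lambda>i j. K i j - K i a - K a j + K a a)"
  unfolding psd_kernel_def
proof
  fix c :: "'a \<Rightarrow> complex"
  let ?K = "\<lambda>i j. K i j - K i a - K a j + K a a"
  obtain T where T: "S = insert a T" "a \<notin> T" using assms(3) by (metis Set.set_insert)
  have fT: "finite T" using assms(1) T by simp
  define s where "s = sum c T"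
  define c' where "c' = c(a := - s)"
  have eq: "c' j = c j" if "j \<in> T" for j using that T by (auto simp: c'_def)
  have s: "hform T K c' = hform T K c" "(\<Sum>j\<in>T. K a j * c' j) = (\<Sum>j\<in>T. K a j * c j)"
    "(\<Sum>i\<in>T. cnj (c' i) * K i a) = (\<Sum>i\<in>T. cnj (c i) * K i a)" "sum c' T = s"
    unfolding s_def using eq by (auto intro!: hform_cong sum.cong)
  have "hform S ?K c = hform T ?K c"
    unfolding T hform_insert[OF fT T(2)] by simp
  \<comment> \<open>The factors \<open>1\<close> turn every correction term into an instance of
    \<open>hform_rank1\<close>.\<close>
  also have "\<dots> = hform T (\<lambda>i j. K i j - K i a * 1 - 1 * K a j + K a a * 1) c" by simp
  also have "\<dots> = hform T K c - (\<Sum>i\<in>T. cnj (c i) * K i a) * s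
      - cnj s * (\<Sum>j\<in>T. K a j * c j) + cnj s * K a a * s"
    unfolding hform_add hform_diff hform_rank1 by (simp add: s_def flip: sum_distrib_right)
  also have "\<dots> = hform S K c'"
    unfolding T hform_insert[OF fT T(2)] s by (simp add: c'_def)
  also have "0 \<le> \<dots>"
  proof -
    have "sum c' S = 0" using fT T s(4) by (simp add: c'_def)
    then show ?thesis by (rule cpsd_kernel_nonneg[OF assms(2)])
  qed
  finally show "0 \<le> hform S ?K c" .
qed

lemma cnj_exp: "cnj (exp z) = exp (cnj z)"
  by (simp add: complex_eq_iff Re_exp Im_exp)

lemma cpsd_kernel_exp:
  assumes "finite S" "cpsd_kernel S K"
  shows "psd_kernel S (\<lambda>i j. exp (K i j))"
proof (cases "S = {}")
  case True
  then show ?thesis by (simp add: psd_kernel_def hform_def)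
next
  case False
  then obtain a where a: "a \<in> S" by auto
  \<comment> \<open>Each factor takes half of \<open>K a a\<close>: by Hermitian symmetry
    \<open>?u i + cnj (?u j) = K i a + K a j - K a a\<close>, which undoes the centering.\<close>
  let ?u = "\<lambda>i. K i a - K a a / 2"
  have "psd_kernel S (\<lambda>i j. exp (K i j - K i a - K a j + K a a) * (exp (?u i) * cnj (exp (?u j))))"
    using assms a by (intro psd_kernel_mult psd_kernel_exp psd_kernel_rank1 cpsd_kernel_centered)
  also have "?this \<longleftrightarrow> ?thesis"
  proof (rule psd_kernel_cong)
    fix i j assume ij: "i \<in> S" "j \<in> S"
    have herm: "cnj (K j a) = K a j" "cnj (K a a) = K a a"
      using cpsd_kernel_hermitian[OF assms(2) _ a] a ij by metis+
    show "exp (K i j - K i a - K a j + K a a) * (exp (?u i) * cnj (exp (?u j))) = exp (K i j)"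
      by (simp add: cnj_exp herm flip: exp_add)
  qed
  finally show ?thesis .
qed

text \<open>These are difference quotients of \<open>exp (h * z)\<close> at \<open>h = 0\<close>,
  along the nonzero steps \<open>h = 1 / Suc n\<close>.\<close>

lemma exp_quotient_LIMSEQ:
  "(\<lambda>n. of_nat (Suc n) * (exp (of_real (1 / Suc n) * z) - 1)) \<longlonglongrightarrow> (z::complex)"
proof -
  have "((\<lambda>h. exp (h * z)) has_field_derivative z) (at 0)"
    by (auto intro!: derivative_eq_intros)
  then have *: "((\<lambda>h. (exp (h * z) - 1) / h) \<longlongrightarrow> z) (at 0)"
    by (simp add: has_field_derivative_iff)
  have "filterlim (\<lambda>n. complex_of_real (1 / Suc n)) (at 0) sequentially"
    unfolding filterlim_at
  proof
    have "(\<lambda>n. complex_of_real (inverse (Suc n))) \<longlonglongrightarrow> of_real 0"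
      by (intro tendsto_of_real LIMSEQ_inverse_real_of_nat)
    then show "(\<lambda>n. complex_of_real (1 / Suc n)) \<longlonglongrightarrow> 0" by (simp add: inverse_eq_divide)
  qed (auto simp: eventually_sequentially simp del: of_nat_Suc)
  from filterlim_compose[OF * this] show ?thesis
    by (simp add: mult.commute del: of_nat_Suc)
qed

lemma cpsd_kernel_scale:
  assumes "0 \<le> r" "cpsd_kernel S K"
  shows "cpsd_kernel S (\<lambda>i j. of_real r * K i j)"
  unfolding cpsd_kernel_def hform_scale
proof (intro conjI ballI allI impI)
  fix i j assume "i \<in> S" "j \<in> S"
  then show "of_real r * K j i = cnj (of_real r * K i j)"
    by (subst cpsd_kernel_hermitian[OF assms(2)]) simp_all
next
  fix c :: "'a \<Rightarrow> complex" assume "sum c S = 0"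
  then show "0 \<le> of_real r * hform S K c"
    using assms(1) cpsd_kernel_nonneg[OF assms(2)]
    by (intro mult_nonneg_nonneg) (simp_all add: less_eq_complex_def)
qed

theorem cpsd_kernel_iff_exp:
  assumes fin: "finite S"
  shows "cpsd_kernel S K \<longleftrightarrow> (\<forall>t>0. psd_kernel S (\<lambda>i j. exp (complex_of_real t * K i j)))"
proof (intro iffI allI impI)
  fix t :: real assume "cpsd_kernel S K" "t > 0"
  then show "psd_kernel S (\<lambda>i j. exp (complex_of_real t * K i j))"
    using cpsd_kernel_exp[OF fin cpsd_kernel_scale] by simp
next
  assume psd: "\<forall>t>0. psd_kernel S (\<lambda>i j. exp (complex_of_real t * K i j))"
  show "cpsd_kernel S K"
  proof (rule cpsd_kernel_LIMSEQ)
    fix n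
    define E where "E i j = exp (of_real (1 / Suc n) * K i j)" for i j
    have psdE: "psd_kernel S E"
      unfolding E_def using psd[rule_format, of "1 / Suc n"] by (simp del: of_nat_Suc)
    have herm: "E j i - 1 = cnj (E i j - 1)" if "i \<in> S" "j \<in> S" for i j
      using psd_kernel_hermitian[OF psdE fin that] by simp
    have "0 \<le> hform S (\<lambda>i j. E i j - 1) c" if "sum c S = 0" for c
    proof -
      \<comment> \<open>The constant kernel has rank one, and its form contains the factor
        \<open>sum c S = 0\<close>.\<close>
      have "hform S (\<lambda>i j. E i j - 1 * 1) c = hform S E c"
        unfolding hform_diff hform_rank1 using that by simp
      then show ?thesis using psdE by (simp add: psd_kernel_def)
    qed
    with herm have "cpsd_kernel S (\<lambda>i j. E i j - 1)"
      unfolding cpsd_kernel_def by blast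
    from cpsd_kernel_scale[OF _ this, of "Suc n"]
    show "cpsd_kernel S (\<lambda>i j. of_nat (Suc n) * (exp (of_real (1 / Suc n) * K i j) - 1))"
      by (simp add: E_def del: of_nat_Suc)
  qed (rule exp_quotient_LIMSEQ)
qed

section \<open>Block matrices\<close>

lemma quad_form_mat: "quad_form (mat n n f) c = hform {..<n} (\<lambda>i j. f (i, j)) (($) c)"
  by (simp add: quad_form_def hform_def)

lemma pos_semidef_mat_iff:
  "pos_semidef (mat n n f) \<longleftrightarrow> psd_kernel {..<n} (\<lambda>i j. f (i, j))"
proof
  assume *: "pos_semidef (mat n n f)"
  show "psd_kernel {..<n} (\<lambda>i j. f (i, j))"
    unfolding psd_kernel_def
  proof
    fix c
    have "0 \<le> quad_form (mat n n f) (vec n c)" using * by (simp add: pos_semidef_def)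
    also have "\<dots> = hform {..<n} (\<lambda>i j. f (i, j)) c"
      unfolding quad_form_mat by (intro hform_cong) auto
    finally show "0 \<le> hform {..<n} (\<lambda>i j. f (i, j)) c" .
  qed
qed (simp add: pos_semidef_def psd_kernel_def quad_form_mat)

lemma dim_mat_adjoint [simp]:
  "dim_row (mat_adjoint A) = dim_col A" "dim_col (mat_adjoint A) = dim_row A"
  by (simp_all add: mat_adjoint_def)

lemma index_mat_adjoint:
  "i < dim_col A \<Longrightarrow> j < dim_row A \<Longrightarrow> mat_adjoint A $$ (i, j) = conjugate (A $$ (j, i))"
  by (simp add: mat_adjoint_def mat_of_rows_index)

lemma cond_pos_semidef_mat_iff:
  "cond_pos_semidef (mat n n f) \<longleftrightarrow> cpsd_kernel {..<n} (\<lambda>i j. f (i, j))"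
proof -
  have "mat_adjoint (mat n n f) = mat n n f \<longleftrightarrow> (\<forall>i<n. \<forall>j<n. f (j, i) = cnj (f (i, j)))"
    unfolding mat_eq_iff by (simp add: index_mat_adjoint) metis
  moreover have "(\<forall>c\<in>carrier_vec n. (\<Sum>j<n. c $ j) = 0 \<longrightarrow> 0 \<le> quad_form (mat n n f) c) \<longleftrightarrow>
      (\<forall>c. sum c {..<n} = 0 \<longrightarrow> 0 \<le> hform {..<n} (\<lambda>i j. f (i, j)) c)"
  proof (intro iffI allI impI)
    fix c :: "nat \<Rightarrow> complex"
    assume *: "\<forall>c\<in>carrier_vec n. (\<Sum>j<n. c $ j) = 0 \<longrightarrow> 0 \<le> quad_form (mat n n f) c"
      and "sum c {..<n} = 0"
    then have "0 \<le> quad_form (mat n n f) (vec n c)" by simp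
    also have "\<dots> = hform {..<n} (\<lambda>i j. f (i, j)) c"
      unfolding quad_form_mat by (intro hform_cong) auto
    finally show "0 \<le> hform {..<n} (\<lambda>i j. f (i, j)) c" .
  qed (simp add: quad_form_mat)
  ultimately show ?thesis
    unfolding cond_pos_semidef_def cpsd_kernel_def by (simp add: Ball_def)
qed

lemma sum_lessThan_add: "sum g {..<a + b :: nat} = sum g {..<a} + (\<Sum>i<b. g (a + i))"
  for g :: "nat \<Rightarrow> 'a :: comm_monoid_add"
  by (induction b) (simp_all add: add_ac)

text \<open>Pairing each index \<open>i\<close> with a second index \<open>n + i\<close> of opposite weight makes the total
  weight zero for arbitrary \<open>c\<close>.\<close>

lemma cpsd_kernel_doubled:
  fixes n :: nat
  assumes "cpsd_kernel {..<n + n} K"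
  shows "0 \<le> hform {..<n} (\<lambda>i j. K i j - K i (n + j) - K (n + i) j + K (n + i) (n + j)) c"
proof -
  define d where "d i = (if i < n then c i else - c (i - n))" for i
  have "sum d {..<n + n} = 0"
    by (simp add: sum_lessThan_add d_def sum_negf)
  then have "0 \<le> hform {..<n + n} K d" by (rule cpsd_kernel_nonneg[OF assms])
  also have "\<dots> = hform {..<n} (\<lambda>i j. K i j - K i (n + j) - K (n + i) j + K (n + i) (n + j)) c"
    by (simp add: hform_def sum_lessThan_add d_def sum_negf sum.distrib sum_subtractf algebra_simps)
  finally show ?thesis .
qed

theorem theorem4p9:
  fixes m :: nat and F :: "real ^ 'n \<Rightarrow> complex mat"
  assumes "m \<ge> 1" and "\<And>x. F x \<in> carrier_mat m m"
  shows
    "(cond_pos_semidef_fun m F \<longleftrightarrow>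
        (\<forall>t::real. t > 0 \<longrightarrow> pos_semidef_fun m (exp_H (\<lambda>x. complex_of_real t \<cdot>\<^sub>m F x)))) \<and>
     ((cond_pos_semidef_fun m F \<or>
        (\<forall>t::real. t > 0 \<longrightarrow> pos_semidef_fun m (exp_H (\<lambda>x. complex_of_real t \<cdot>\<^sub>m F x)))) \<and>
      neg_semidef (F 0) \<longrightarrow>
        (\<forall>(N::nat) (x :: nat \<Rightarrow> real ^ 'n).
           pos_semidef (block_mat m N (\<lambda>p q. F (x p - x q) - F (x p) - mat_adjoint (F (x q))))))"
proof -
  \<comment> \<open>Index \<open>i\<close> stands for row \<open>i mod m\<close> of block
    \<open>i div m\<close>; the number of blocks enters only through the index set.\<close>
  define k :: "(nat \<Rightarrow> real ^ 'n) \<Rightarrow> nat \<Rightarrow> nat \<Rightarrow> complex"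
    where "k x i j = F (x (i div m) - x (j div m)) $$ (i mod m, j mod m)" for x i j
  have dim [simp]: "dim_row (F x) = m" "dim_col (F x) = m" for x
    using assms(2)[of x] by auto
  have lt [simp]: "i mod m < m" for i using assms(1) by simp
  have cond: "cond_pos_semidef_fun m F \<longleftrightarrow> (\<forall>N x. cpsd_kernel {..<m * N} (k x))"
    by (simp add: cond_pos_semidef_fun_def block_mat_def cond_pos_semidef_mat_iff k_def[abs_def])
  have "pos_semidef_fun m (exp_H (\<lambda>x. complex_of_real t \<cdot>\<^sub>m F x)) \<longleftrightarrow>
      (\<forall>N x. psd_kernel {..<m * N} (\<lambda>i j. exp (complex_of_real t * k x i j)))" for t
    by (simp add: pos_semidef_fun_def block_mat_def pos_semidef_mat_iff exp_H_def k_def)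
  then have equiv: "cond_pos_semidef_fun m F \<longleftrightarrow>
      (\<forall>t::real. t > 0 \<longrightarrow> pos_semidef_fun m (exp_H (\<lambda>x. complex_of_real t \<cdot>\<^sub>m F x)))"
    unfolding cond by (auto simp: cpsd_kernel_iff_exp)
  have "pos_semidef (block_mat m N (\<lambda>p q. F (x p - x q) - F (x p) - mat_adjoint (F (x q))))"
    if cF: "cond_pos_semidef_fun m F" and neg: "neg_semidef (F 0)" for N and x :: "nat \<Rightarrow> real ^ 'n"
  proof -
    define n where "n = m * N"
    \<comment> \<open>Appending \<open>N\<close> copies of \<open>0\<close> makes the off-diagonal
      quarters of the doubled matrix consist of \<open>F (x p)\<close> and \<open>F (- x q)\<close>,
      and the last quarter of \<open>F 0\<close>.\<close>
    define y where "y p = (if p < N then x p else 0)" for p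
    define A where "A i j = k x i j - F (x (i div m)) $$ (i mod m, j mod m)
      - cnj (F (x (j div m)) $$ (j mod m, i mod m))" for i j
    define B where "B i j = F 0 $$ (i mod m, j mod m)" for i j
    have "n + n = m * (N + N)" by (simp add: n_def algebra_simps)
    then have csd: "cpsd_kernel {..<n + n} (k y)" using cF cond by simp
    have div: "i div m < N" if "i < n" for i
      using that by (simp add: n_def less_mult_imp_div_less mult.commute)
    have shift: "(n + i) div m = N + i div m" "(n + i) mod m = i mod m" for i
      using assms(1) by (simp_all add: n_def)
    have "psd_kernel {..<m} (\<lambda>i j. - (F 0 $$ (i, j)))"
    proof -
      have "- F 0 = mat m m (\<lambda>(i, j). - (F 0 $$ (i, j)))" by (rule eq_matI) auto
      then show ?thesis using neg by (simp add: neg_semidef_def pos_semidef_mat_iff)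
    qed
    \<comment> \<open>\<open>B\<close> repeats \<open>F 0\<close> in every block, so it is the
      pullback of \<open>F 0\<close> along \<open>i mod m\<close>.\<close>
    then have "psd_kernel {..<n} (\<lambda>i j. - 1 * B i j)"
      using psd_kernel_pullback[of "{..<m}" _ "{..<n}" "\<lambda>i. i mod m"] by (force simp: B_def)
    then have B: "0 \<le> - hform {..<n} B c" for c
      unfolding psd_kernel_def hform_scale by simp
    have "psd_kernel {..<n} A"
      unfolding psd_kernel_def
    proof
      fix c
      \<comment> \<open>The doubled form exceeds that of \<open>A\<close> by the form of
        \<open>B\<close>, which is at most \<open>0\<close>; hence its nonnegativity passes to
        \<open>A\<close>.\<close>
      have "hform {..<n} (\<lambda>i j. k y i j - k y i (n + j) - k y (n + i) j + k y (n + i) (n + j)) c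
        = hform {..<n} (\<lambda>i j. A i j + B i j) c"
      proof (intro hform_cong refl)
        fix i j assume "i \<in> {..<n}" "j \<in> {..<n}"
        then have ij: "i < n" "j < n" by auto
        \<comment> \<open>Hermitian symmetry of the doubled matrix replaces \<open>F (- x q)\<close>
          by the adjoint of \<open>F (x q)\<close>.\<close>
        have "k y (n + i) j = cnj (k y j (n + i))"
          using ij by (intro cpsd_kernel_hermitian[OF csd]) auto
        then show "k y i j - k y i (n + j) - k y (n + i) j + k y (n + i) (n + j) = A i j + B i j"
          using div ij by (simp add: k_def A_def B_def shift y_def)
      qed
      then show "0 \<le> hform {..<n} A c"
        using add_nonneg_nonneg[OF cpsd_kernel_doubled[OF csd, of c] B[of c]] by (simp add: hform_add)
    qed
    then show ?thesis
      by (simp add: block_mat_def pos_semidef_mat_iff A_def[abs_def] k_def n_def index_mat_adjoint)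
  qed
  with equiv show ?thesis by blast
qed

end
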